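(* Let $a,b\ge 1$ be integers, let $q:=\frac{\max\{a,b\}}{\min\{a,b\}}$, and consider the sub-Riemannian manifold $(\mathbb{R}^3,\mathcal{D},g)$ where $\mathcal{D}=\mathrm{span}\{X_1,X_2\}$, with $$X_1(x)=\partial_{x_1},\qquad X_2(x)=\partial_{x_2}+P(x)^2\,\partial_{x_3},\qquad P(x)=x_1^a-x_2^b,$$ and $g$ is the metric making $X_1,X_2$ orthonormal. For $\varepsilon>0$ and each of the four independent choices of signs, let $\gamma_\varepsilon^{\pm,\pm}:[0,\varepsilon]\to\mathbb{R}^3$ be the curve $$\gamma_\varepsilon^{\pm,\pm}(t)=\begin{cases}(\pm t^{q},\pm t,0), & b\ge a,\\ (\pm t,\pm t^{q},0), & a\ge b,\end{cases}$$ where the first superscript is the sign of the first coordinate and the second superscript is the sign of the second coordinate. If $b>a\ge 3$, or $a=2$ and $b=3$, or $a>b\ge 3$, or $b=2$ and $a=3$, then for every $\varepsilon>0$ every curve $\gamma_\varepsilon^{\pm,\pm}$ is not length-minimizing in $(\mathbb{R}^3,\mathcal{D},g)$.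
   Context: An absolutely continuous curve $\eta:[0,\tau]\to\mathbb{R}^3$ is horizontal if there is a control $u=(u_1,u_2)\in L^2([0,\tau],\mathbb{R}^2)$ with $\dot\eta(t)=u_1(t)X_1(\eta(t))+u_2(t)X_2(\eta(t))$ for a.e. $t$. Its sub-Riemannian length is $L_{\mathrm{sR}}(\eta)=\int_0^\tau\sqrt{g(\dot\eta(t),\dot\eta(t))}\,dt=\int_0^\tau\sqrt{u_1(t)^2+u_2(t)^2}\,dt$. A curve $\eta:[0,\tau]\to\mathbb{R}^3$ is length-minimizing if it is horizontal and $L_{\mathrm{sR}}(\eta)\le L_{\mathrm{sR}}(\widetilde\eta)$ for every horizontal curve $\widetilde\eta:[0,\tau]\to\mathbb{R}^3$ with $\widetilde\eta(0)=\eta(0)$ and $\widetilde\eta(\tau)=\eta(\tau)$. *)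

theory Defs
  imports "HOL-Analysis.Analysis"
begin

section \<open>Rank-two sub-Riemannian structures given by a frame\<close>

text \<open>Absolute continuity of a curve on a compact interval; the finite families of
  non-overlapping subintervals are indexed by the naturals below some n.\<close>

definition absolutely_continuous_curve ::
    "real \<Rightarrow> real \<Rightarrow> (real \<Rightarrow> 'a::metric_space) \<Rightarrow> bool" where
  "absolutely_continuous_curve c d f \<longleftrightarrow>
     (\<forall>e>0. \<exists>\<delta>>0. \<forall>(n::nat) s t.
        (\<forall>i<n. c \<le> s i \<and> s i \<le> t i \<and> t i \<le> d) \<and>
        disjoint_family_on (\<lambda>i. {s i<..<t i}) {..<n} \<and>
        (\<Sum>i<n. t i - s i) < \<delta> \<longrightarrow>
        (\<Sum>i<n. dist (f (s i)) (f (t i))) < e)"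

definition L2_on :: "real set \<Rightarrow> (real \<Rightarrow> real) \<Rightarrow> bool" where
  "L2_on S u \<longleftrightarrow> u \<in> borel_measurable (lebesgue_on S) \<and>
     integrable (lebesgue_on S) (\<lambda>t. (u t)\<^sup>2)"

text \<open>Values of a curve outside the interval from 0 to \<open>\<tau>\<close> play no role below; derivatives are
  taken within this interval.\<close>

definition horizontal ::
    "('a::euclidean_space \<Rightarrow> 'a) \<Rightarrow> ('a \<Rightarrow> 'a) \<Rightarrow> real \<Rightarrow> (real \<Rightarrow> 'a) \<Rightarrow> bool" where
  "horizontal X Y \<tau> \<eta> \<longleftrightarrow>
     absolutely_continuous_curve 0 \<tau> \<eta> \<and>
     (\<exists>u1 u2. L2_on {0..\<tau>} u1 \<and> L2_on {0..\<tau>} u2 \<and>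
        (AE t in lebesgue_on {0..\<tau>}.
           (\<eta> has_vector_derivative (u1 t *\<^sub>R X (\<eta> t) + u2 t *\<^sub>R Y (\<eta> t)))
             (at t within {0..\<tau>})))"

text \<open>The metric on the span of X and Y that makes these two vector fields orthonormal. It is
  meaningful only where X and Y are linearly independent, and only for vectors in their span;
  elsewhere the value is unspecified.\<close>

definition sR_metric ::
    "('a::euclidean_space \<Rightarrow> 'a) \<Rightarrow> ('a \<Rightarrow> 'a) \<Rightarrow> 'a \<Rightarrow> 'a \<Rightarrow> 'a \<Rightarrow> real" where
  "sR_metric X Y x v w =
     (THE r. \<exists>v1 v2 w1 w2.
        v = v1 *\<^sub>R X x + v2 *\<^sub>R Y x \<and> w = w1 *\<^sub>R X x + w2 *\<^sub>R Y x \<and>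
        r = v1 * w1 + v2 * w2)"

definition sR_length ::
    "('a::euclidean_space \<Rightarrow> 'a) \<Rightarrow> ('a \<Rightarrow> 'a) \<Rightarrow> real \<Rightarrow> (real \<Rightarrow> 'a) \<Rightarrow> real" where
  "sR_length X Y \<tau> \<eta> =
     (LINT t|lebesgue_on {0..\<tau>}.
        sqrt (sR_metric X Y (\<eta> t)
          (vector_derivative \<eta> (at t within {0..\<tau>}))
          (vector_derivative \<eta> (at t within {0..\<tau>}))))"

definition length_minimizing ::
    "('a::euclidean_space \<Rightarrow> 'a) \<Rightarrow> ('a \<Rightarrow> 'a) \<Rightarrow> real \<Rightarrow> (real \<Rightarrow> 'a) \<Rightarrow> bool" where
  "length_minimizing X Y \<tau> \<eta> \<longleftrightarrow>
     horizontal X Y \<tau> \<eta> \<and>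
     (\<forall>\<theta>. horizontal X Y \<tau> \<theta> \<and> \<theta> 0 = \<eta> 0 \<and> \<theta> \<tau> = \<eta> \<tau> \<longrightarrow>
        sR_length X Y \<tau> \<eta> \<le> sR_length X Y \<tau> \<theta>)"

section \<open>The structure and the curves\<close>

definition P :: "nat \<Rightarrow> nat \<Rightarrow> real^3 \<Rightarrow> real" where
  "P a b x = (x $ 1) ^ a - (x $ 2) ^ b"

definition X1 :: "real^3 \<Rightarrow> real^3" where
  "X1 x = axis 1 1"

definition X2 :: "nat \<Rightarrow> nat \<Rightarrow> real^3 \<Rightarrow> real^3" where
  "X2 a b x = axis 2 1 + (P a b x)\<^sup>2 *\<^sub>R axis 3 1"

lemma sR_metric_X1_X2:
  "sR_metric X1 (X2 a b) x
     (v1 *\<^sub>R X1 x + v2 *\<^sub>R X2 a b x) (w1 *\<^sub>R X1 x + w2 *\<^sub>R X2 a b x) = v1 * w1 + v2 * w2"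
  unfolding sR_metric_def
  by (rule the_equality) (auto simp: X1_def X2_def vec_eq_iff axis_def forall_3)

definition q :: "nat \<Rightarrow> nat \<Rightarrow> real" where
  "q a b = real (max a b) / real (min a b)"

text \<open>The reals \<open>\<sigma>1\<close> and \<open>\<sigma>2\<close> are the signs, to be taken from -1 and 1. For a = b the exponent
  is 1, so that for nonnegative t both branches agree.\<close>

definition \<gamma> :: "nat \<Rightarrow> nat \<Rightarrow> real \<Rightarrow> real \<Rightarrow> real \<Rightarrow> real^3" where
  "\<gamma> a b \<sigma>1 \<sigma>2 t =
     (if b \<ge> a then vector [\<sigma>1 * t powr q a b, \<sigma>2 * t, 0]
      else vector [\<sigma>1 * t, \<sigma>2 * t powr q a b, 0])"

end

theory Submission
  imports Defs
begin

text \<open>A horizontal curve is the lift of a planar curve \<open>(x, y)\<close> with height the integral of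
\<open>P\<^sup>2 dy\<close>, where \<open>P = x\<^sup>a - y\<^sup>b\<close>, and its length is the Euclidean length of the planar curve. If the signs are
such that \<open>P\<close> does not vanish on the curve, then the curve is not horizontal and there is nothing
more to do (lemma \<open>power_curve_not_horizontal\<close>). Otherwise a reflection reduces the problem to the
curve \<open>(t\<^sup>\<alpha>, t\<^sup>\<beta>, 0)\<close>, where one of \<open>\<alpha>\<close>, \<open>\<beta>\<close> is 1 and the other is \<open>q > 1\<close>, and
\<open>\<alpha> a = \<beta> b = n\<close> with \<open>n = max a b\<close>.

This curve is not straight at the origin, where \<open>P\<close> is very flat, and it can be shortened there. Its
initial piece up to time \<open>h\<close> is replaced by the chord. This saves a length of order \<open>h\<^bsup>2q-1\<^esup>\<close>
(lemma \<open>chord_shorter_than_power_curve\<close>) and produces an error in the height of order at most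
\<open>h\<^bsup>2n+1\<^esup>\<close> (lemma \<open>joined_by_chord\<close>). The error is then removed at the far end point, which does not
depend on \<open>h\<close>: a small square loop with side \<open>r\<close>, run through in the direction that lowers the height,
changes the height by an amount of order at least \<open>r\<^sup>3\<close> (lemma \<open>square_defect_ge\<close>). Hence a loop of length of order
\<open>h\<^bsup>(2n+1)/3\<^esup>\<close> suffices, and this is shorter than what was saved, for small \<open>h\<close>, as soon as
\<open>(2n + 1)/3 > 2q - 1\<close>, that is, \<open>6q < 2n + 4\<close>. Since \<open>q = n / min a b\<close>, this holds if
\<open>min a b \<ge> 3\<close>, and also if \<open>min a b = 2\<close> and \<open>n = 3\<close>.\<close>

section \<open>Lipschitz horizontal arcs and their lengths\<close>

lemma AE_lebesgue_on_Icc_finite_exceptions: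
  fixes c d :: real
  assumes "finite S" and "\<And>t. t \<in> {c<..<d} - S \<Longrightarrow> Q t"
  shows "AE t in lebesgue_on {c..d}. Q t"
proof -
  have "S \<union> {c, d} \<in> null_sets lebesgue"
    using assms(1) by (intro null_sets_completionI finite_imp_null_set_lborel) auto
  moreover have "{t \<in> space lebesgue. \<not> (t \<in> {c..d} \<longrightarrow> Q t)} \<subseteq> S \<union> {c, d}"
    using assms(2) by force
  ultimately have "AE t in lebesgue. t \<in> {c..d} \<longrightarrow> Q t"
    by (rule AE_I')
  then show ?thesis
    by (simp add: AE_restrict_space_iff)
qed

lemma lipschitz_imp_absolutely_continuous_curve:
  assumes "L-lipschitz_on {c..d} f"
  shows "absolutely_continuous_curve c d f"
  unfolding absolutely_continuous_curve_def
proof (intro allI impI)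
  fix e :: real assume "e > 0"
  have L: "L \<ge> 0" using assms by (rule lipschitz_on_nonneg)
  have "(\<Sum>i<n. dist (f (s i)) (f (t i))) < e"
    if st: "\<forall>i<n. c \<le> s i \<and> s i \<le> t i \<and> t i \<le> d" and sum: "(\<Sum>i<n. t i - s i) < e / (L + 1)"
    for n :: nat and s t
  proof -
    have "(\<Sum>i<n. dist (f (s i)) (f (t i))) \<le> (\<Sum>i<n. L * (t i - s i))"
    proof (rule sum_mono)
      fix i assume "i \<in> {..<n}"
      then have "s i \<in> {c..d}" "t i \<in> {c..d}" "dist (s i) (t i) = t i - s i"
        using st by (force simp: dist_real_def)+
      then show "dist (f (s i)) (f (t i)) \<le> L * (t i - s i)"
        using lipschitz_onD[OF assms] by metis
    qed
    also have "\<dots> = L * (\<Sum>i<n. t i - s i)" by (simp add: sum_distrib_left)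
    also have "\<dots> \<le> L * (e / (L + 1))" using sum L by (intro mult_left_mono) auto
    also have "\<dots> < e" using L \<open>e > 0\<close> by (simp add: field_simps)
    finally show ?thesis .
  qed
  moreover have "e / (L + 1) > 0" using L \<open>e > 0\<close> by simp
  ultimately show "\<exists>\<delta>>0. \<forall>(n::nat) s t.
        (\<forall>i<n. c \<le> s i \<and> s i \<le> t i \<and> t i \<le> d) \<and>
        disjoint_family_on (\<lambda>i. {s i<..<t i}) {..<n} \<and>
        (\<Sum>i<n. t i - s i) < \<delta> \<longrightarrow>
        (\<Sum>i<n. dist (f (s i)) (f (t i))) < e" by blast
qed

lemma bounded_borel_imp_L2_on:
  assumes [measurable]: "u \<in> borel_measurable borel" and "\<And>t. \<bar>u t\<bar> \<le> L"
  shows "L2_on {c..d} u"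
proof -
  have 1: "u \<in> borel_measurable (lebesgue_on {c..d})"
    by (intro measurable_restrict_space1 measurable_completion) (simp add: assms)
  interpret finite_measure "lebesgue_on {c..d}"
    by (rule finite_measure_lebesgue_on) auto
  have "(u t)\<^sup>2 \<le> L\<^sup>2" for t
    using power_mono[OF assms(2)[of t] abs_ge_zero, of 2] by simp
  then have "integrable (lebesgue_on {c..d}) (\<lambda>t. (u t)\<^sup>2)"
    using 1 by (intro integrable_const_bound[where B="L\<^sup>2"]) auto
  with 1 show ?thesis by (simp add: L2_on_def)
qed

text \<open>The competitor is glued from smooth pieces, so its velocity exists off a finite set of corners
and its controls are bounded. Recording the controls as Borel functions on the whole line makes
measurability survive gluing and reparametrization without further argument, and the Lipschitz
bound gives absolute continuity.\<close>

definition lipschitz_horizontal ::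
    "('a::euclidean_space \<Rightarrow> 'a) \<Rightarrow> ('a \<Rightarrow> 'a) \<Rightarrow> real \<Rightarrow> (real \<Rightarrow> 'a) \<Rightarrow>
      (real \<Rightarrow> real) \<Rightarrow> (real \<Rightarrow> real) \<Rightarrow> bool" where
  "lipschitz_horizontal X Y \<tau> \<eta> u v \<longleftrightarrow>
     0 < \<tau> \<and> u \<in> borel_measurable borel \<and> v \<in> borel_measurable borel \<and>
     (\<exists>L. L-lipschitz_on {0..\<tau>} \<eta> \<and> (\<forall>t. \<bar>u t\<bar> \<le> L \<and> \<bar>v t\<bar> \<le> L)) \<and>
     (\<exists>S. finite S \<and> (\<forall>t\<in>{0<..<\<tau>} - S.
        (\<eta> has_vector_derivative (u t *\<^sub>R X (\<eta> t) + v t *\<^sub>R Y (\<eta> t))) (at t)))"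

lemma lipschitz_horizontal_imp_horizontal:
  assumes "lipschitz_horizontal X Y \<tau> \<eta> u v"
  shows "horizontal X Y \<tau> \<eta>"
proof -
  from assms obtain L S where *: "u \<in> borel_measurable borel" "v \<in> borel_measurable borel"
    "L-lipschitz_on {0..\<tau>} \<eta>" "\<And>t. \<bar>u t\<bar> \<le> L" "\<And>t. \<bar>v t\<bar> \<le> L" "finite S"
    "\<And>t. t \<in> {0<..<\<tau>} - S \<Longrightarrow>
        (\<eta> has_vector_derivative (u t *\<^sub>R X (\<eta> t) + v t *\<^sub>R Y (\<eta> t))) (at t)"
    unfolding lipschitz_horizontal_def by blast
  show ?thesis
    unfolding horizontal_def
    using * by (intro conjI exI[of _ u] exI[of _ v] lipschitz_imp_absolutely_continuous_curve
        bounded_borel_imp_L2_on AE_lebesgue_on_Icc_finite_exceptions[of S])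
      (auto intro: has_vector_derivative_at_within)
qed

text \<open>Because the frame is orthonormal for the metric, the length is the integral of the Euclidean norm
of the controls; finitely many times, at which the derivative may fail to exist, do not count.\<close>

lemma sR_length_eq_integral_speed:
  assumes "0 < \<tau>" and "finite S"
    and der: "\<And>t. t \<in> {0<..<\<tau>} - S \<Longrightarrow>
      (\<eta> has_vector_derivative (u t *\<^sub>R X1 (\<eta> t) + v t *\<^sub>R X2 a b (\<eta> t))) (at t)"
    and len: "((\<lambda>t. sqrt ((u t)\<^sup>2 + (v t)\<^sup>2)) has_integral l) {0..\<tau>}"
  shows "sR_length X1 (X2 a b) \<tau> \<eta> = l"
proof -
  let ?g = "\<lambda>t. sqrt (sR_metric X1 (X2 a b) (\<eta> t)
          (vector_derivative \<eta> (at t within {0..\<tau>}))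
          (vector_derivative \<eta> (at t within {0..\<tau>})))"
  have eq: "?g t = sqrt ((u t)\<^sup>2 + (v t)\<^sup>2)" if "t \<in> {0..\<tau>} - (S \<union> {0, \<tau>})" for t
  proof -
    have t: "t \<in> {0<..<\<tau>} - S" using that by auto
    then have "vector_derivative \<eta> (at t within {0..\<tau>})
        = u t *\<^sub>R X1 (\<eta> t) + v t *\<^sub>R X2 a b (\<eta> t)"
      using assms(1) by (intro vector_derivative_at_within_ivl der) auto
    then show ?thesis by (simp add: sR_metric_X1_X2 power2_eq_square)
  qed
  have neg: "negligible (S \<union> {0, \<tau>})" using assms(2) by (auto intro: negligible_finite)
  have "(\<lambda>t. sqrt ((u t)\<^sup>2 + (v t)\<^sup>2)) absolutely_integrable_on {0..\<tau>}"
    using len by (intro nonnegative_absolutely_integrable_1) auto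
  then have "?g absolutely_integrable_on {0..\<tau>}"
    using neg eq by (rule absolutely_integrable_spike)
  then have "integrable (lebesgue_on {0..\<tau>}) ?g"
    by (simp add: integrable_restrict_space set_integrable_def)
  then have "sR_length X1 (X2 a b) \<tau> \<eta> = integral {0..\<tau>} ?g"
    unfolding sR_length_def by (intro lebesgue_integral_eq_integral) auto
  also have "(?g has_integral l) {0..\<tau>}"
    using neg eq len by (rule has_integral_spike)
  then have "integral {0..\<tau>} ?g = l" by (rule integral_unique)
  finally show ?thesis .
qed

text \<open>The duration of the arc is existentially quantified: arcs can then be concatenated without
reparametrizing each piece, and the prescribed duration is restored once, at the end.\<close>

definition joined_by_length ::
    "('a::euclidean_space \<Rightarrow> 'a) \<Rightarrow> ('a \<Rightarrow> 'a) \<Rightarrow> 'a \<Rightarrow> 'a \<Rightarrow> real \<Rightarrow> bool" where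
  "joined_by_length X Y p p' l \<longleftrightarrow>
     (\<exists>\<tau> \<eta> u v. lipschitz_horizontal X Y \<tau> \<eta> u v \<and> \<eta> 0 = p \<and> \<eta> \<tau> = p' \<and>
        ((\<lambda>t. sqrt ((u t)\<^sup>2 + (v t)\<^sup>2)) has_integral l) {0..\<tau>})"

lemma joined_by_length_trans:
  assumes "joined_by_length X Y p p' l" and "joined_by_length X Y p' p'' l'"
  shows "joined_by_length X Y p p'' (l + l')"
proof -
  from assms(1) obtain \<tau>1 \<eta>1 u1 v1 L1 S1 where
    1: "0 < \<tau>1" "u1 \<in> borel_measurable borel" "v1 \<in> borel_measurable borel"
      "L1-lipschitz_on {0..\<tau>1} \<eta>1" "\<And>t. \<bar>u1 t\<bar> \<le> L1" "\<And>t. \<bar>v1 t\<bar> \<le> L1" "finite S1"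
      "\<And>t. t \<in> {0<..<\<tau>1} - S1 \<Longrightarrow>
        (\<eta>1 has_vector_derivative (u1 t *\<^sub>R X (\<eta>1 t) + v1 t *\<^sub>R Y (\<eta>1 t))) (at t)"
      "\<eta>1 0 = p" "\<eta>1 \<tau>1 = p'" "((\<lambda>t. sqrt ((u1 t)\<^sup>2 + (v1 t)\<^sup>2)) has_integral l) {0..\<tau>1}"
    unfolding joined_by_length_def lipschitz_horizontal_def by blast
  from assms(2) obtain \<tau>2 \<eta>2 u2 v2 L2 S2 where
    2: "0 < \<tau>2" "u2 \<in> borel_measurable borel" "v2 \<in> borel_measurable borel"
      "L2-lipschitz_on {0..\<tau>2} \<eta>2" "\<And>t. \<bar>u2 t\<bar> \<le> L2" "\<And>t. \<bar>v2 t\<bar> \<le> L2" "finite S2"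
      "\<And>t. t \<in> {0<..<\<tau>2} - S2 \<Longrightarrow>
        (\<eta>2 has_vector_derivative (u2 t *\<^sub>R X (\<eta>2 t) + v2 t *\<^sub>R Y (\<eta>2 t))) (at t)"
      "\<eta>2 0 = p'" "\<eta>2 \<tau>2 = p''" "((\<lambda>t. sqrt ((u2 t)\<^sup>2 + (v2 t)\<^sup>2)) has_integral l') {0..\<tau>2}"
    unfolding joined_by_length_def lipschitz_horizontal_def by blast
  note [measurable] = 1(2,3) 2(2,3)
  define \<eta> where "\<eta> t = (if t \<le> \<tau>1 then \<eta>1 t else \<eta>2 (t - \<tau>1))" for t
  define u where "u t = (if t \<le> \<tau>1 then u1 t else u2 (t - \<tau>1))" for t
  define v where "v t = (if t \<le> \<tau>1 then v1 t else v2 (t - \<tau>1))" for t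
  \<comment> \<open>the junction joins the exceptional set\<close>
  let ?S = "S1 \<union> {\<tau>1} \<union> (\<lambda>t. t + \<tau>1) ` S2"
  have "L2-lipschitz_on {\<tau>1..\<tau>1 + \<tau>2} (\<lambda>t. \<eta>2 (t - \<tau>1))"
  proof (rule lipschitz_onI)
    fix x y assume "x \<in> {\<tau>1..\<tau>1 + \<tau>2}" "y \<in> {\<tau>1..\<tau>1 + \<tau>2}"
    then show "dist (\<eta>2 (x - \<tau>1)) (\<eta>2 (y - \<tau>1)) \<le> L2 * dist x y"
      using lipschitz_onD[OF 2(4), of "x - \<tau>1" "y - \<tau>1"] by (simp add: dist_real_def)
  qed (rule lipschitz_on_nonneg[OF 2(4)])
  with 1(4) have lip: "(max L1 L2)-lipschitz_on {0..\<tau>1 + \<tau>2} \<eta>"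
    unfolding \<eta>_def by (rule lipschitz_on_concat_max) (simp add: 1(10) 2(9))
  have der: "(\<eta> has_vector_derivative (u t *\<^sub>R X (\<eta> t) + v t *\<^sub>R Y (\<eta> t))) (at t)"
    if t: "t \<in> {0<..<\<tau>1 + \<tau>2} - ?S" for t
  proof (cases "t < \<tau>1")
    case True
    have "(\<eta> has_vector_derivative (u1 t *\<^sub>R X (\<eta>1 t) + v1 t *\<^sub>R Y (\<eta>1 t))) (at t)"
      by (rule has_vector_derivative_transform_within_open[OF 1(8), of _ "{..<\<tau>1}"])
        (use t True in \<open>auto simp: \<eta>_def\<close>)
    then show ?thesis using True by (simp add: \<eta>_def u_def v_def)
  next
    case False
    with t have t': "t > \<tau>1" "t - \<tau>1 \<in> {0<..<\<tau>2} - S2" by (force simp: image_iff)+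
    have "((\<lambda>t. t - \<tau>1) has_vector_derivative 1) (at t)"
      by (auto intro!: derivative_eq_intros)
    from vector_diff_chain_at[OF this 2(8)[OF t'(2)]]
    have "((\<lambda>t. \<eta>2 (t - \<tau>1)) has_vector_derivative
        (u2 (t - \<tau>1) *\<^sub>R X (\<eta>2 (t - \<tau>1)) + v2 (t - \<tau>1) *\<^sub>R Y (\<eta>2 (t - \<tau>1)))) (at t)"
      by (simp add: o_def)
    then have "(\<eta> has_vector_derivative
        (u2 (t - \<tau>1) *\<^sub>R X (\<eta>2 (t - \<tau>1)) + v2 (t - \<tau>1) *\<^sub>R Y (\<eta>2 (t - \<tau>1)))) (at t)"
      by (rule has_vector_derivative_transform_within_open[of _ _ _ "{\<tau>1<..}"])
        (use t' in \<open>auto simp: \<eta>_def\<close>)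
    then show ?thesis using t' by (simp add: \<eta>_def u_def v_def)
  qed
  have "lipschitz_horizontal X Y (\<tau>1 + \<tau>2) \<eta> u v"
    unfolding lipschitz_horizontal_def
  proof (intro conjI exI[of _ "max L1 L2"] exI[of _ ?S] ballI allI)
    show "u \<in> borel_measurable borel" "v \<in> borel_measurable borel"
      unfolding u_def v_def by measurable
    show "\<bar>u t\<bar> \<le> max L1 L2" "\<bar>v t\<bar> \<le> max L1 L2" for t
      using 1(5,6)[of t] 2(5,6)[of "t - \<tau>1"] by (auto simp: u_def v_def)
  qed (use 1(1,7) 2(1,7) lip der in auto)
  moreover have "((\<lambda>t. sqrt ((u t)\<^sup>2 + (v t)\<^sup>2)) has_integral (l + l')) {0..\<tau>1 + \<tau>2}"
  proof (rule has_integral_combine[of _ \<tau>1])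
    show "((\<lambda>t. sqrt ((u t)\<^sup>2 + (v t)\<^sup>2)) has_integral l) {0..\<tau>1}"
      using 1(11) by (rule has_integral_eq[rotated]) (simp add: u_def v_def)
    have "((\<lambda>t. sqrt ((u2 (t - \<tau>1))\<^sup>2 + (v2 (t - \<tau>1))\<^sup>2)) has_integral l') {\<tau>1..\<tau>1 + \<tau>2}"
      using has_integral_shift_real_ivl[OF 2(11), of "-\<tau>1"] by (simp add: add.commute)
    then show "((\<lambda>t. sqrt ((u t)\<^sup>2 + (v t)\<^sup>2)) has_integral l') {\<tau>1..\<tau>1 + \<tau>2}"
      by (rule has_integral_spike[of "{\<tau>1}", rotated 2]) (auto simp: u_def v_def)
  qed (use 1(1) 2(1) in auto)
  moreover have "\<eta> 0 = p" "\<eta> (\<tau>1 + \<tau>2) = p''" using 1(1,9) 2(1,10) by (auto simp: \<eta>_def)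
  ultimately show ?thesis unfolding joined_by_length_def by blast
qed

text \<open>A linear map that carries each frame field to itself up to sign changes the controls only by signs
and hence keeps the length.\<close>

lemma joined_by_length_linear_image:
  assumes "joined_by_length X Y p p' l" and R: "bounded_linear R"
    and RX: "\<And>x. R (X x) = \<sigma> *\<^sub>R X' (R x)" and RY: "\<And>x. R (Y x) = \<rho> *\<^sub>R Y' (R x)"
    and sgn: "\<bar>\<sigma>\<bar> = 1" "\<bar>\<rho>\<bar> = 1"
  shows "joined_by_length X' Y' (R p) (R p') l"
proof -
  from assms(1) obtain \<tau> \<eta> u v L S where
    1: "0 < \<tau>" "u \<in> borel_measurable borel" "v \<in> borel_measurable borel"
      "L-lipschitz_on {0..\<tau>} \<eta>" "\<And>t. \<bar>u t\<bar> \<le> L" "\<And>t. \<bar>v t\<bar> \<le> L" "finite S"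
      "\<And>t. t \<in> {0<..<\<tau>} - S \<Longrightarrow>
        (\<eta> has_vector_derivative (u t *\<^sub>R X (\<eta> t) + v t *\<^sub>R Y (\<eta> t))) (at t)"
      "\<eta> 0 = p" "\<eta> \<tau> = p'" "((\<lambda>t. sqrt ((u t)\<^sup>2 + (v t)\<^sup>2)) has_integral l) {0..\<tau>}"
    unfolding joined_by_length_def lipschitz_horizontal_def by blast
  note [measurable] = 1(2,3)
  interpret bounded_linear R by fact
  obtain K where K: "K \<ge> 0" "\<And>x. norm (R x) \<le> norm x * K"
    using nonneg_bounded by blast
  have "(K * L)-lipschitz_on {0..\<tau>} (\<lambda>t. R (\<eta> t))"
  proof (rule lipschitz_on_compose2[OF 1(4)])
    show "K-lipschitz_on (\<eta> ` {0..\<tau>}) R"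
      using K by (auto simp: lipschitz_on_def dist_norm diff[symmetric] mult.commute)
  qed
  then have lip: "(max L (K * L))-lipschitz_on {0..\<tau>} (\<lambda>t. R (\<eta> t))"
    by (rule lipschitz_on_le) simp
  have "lipschitz_horizontal X' Y' \<tau> (\<lambda>t. R (\<eta> t)) (\<lambda>t. \<sigma> * u t) (\<lambda>t. \<rho> * v t)"
    unfolding lipschitz_horizontal_def
  proof (intro conjI exI[of _ "max L (K * L)"] exI[of _ S] ballI allI)
    fix t
    show "\<bar>\<sigma> * u t\<bar> \<le> max L (K * L)" "\<bar>\<rho> * v t\<bar> \<le> max L (K * L)"
      using 1(5,6)[of t] sgn by (auto simp: abs_mult)
    assume "t \<in> {0<..<\<tau>} - S"
    from has_vector_derivative[OF 1(8)[OF this]]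
    show "((\<lambda>t. R (\<eta> t)) has_vector_derivative
        ((\<sigma> * u t) *\<^sub>R X' (R (\<eta> t)) + (\<rho> * v t) *\<^sub>R Y' (R (\<eta> t)))) (at t)"
      by (simp add: add scaleR RX RY mult.commute)
  qed (use 1(1,2,3,7) lip in auto)
  moreover have "((\<lambda>t. sqrt ((\<sigma> * u t)\<^sup>2 + (\<rho> * v t)\<^sup>2)) has_integral l) {0..\<tau>}"
  proof -
    have "\<sigma>\<^sup>2 = 1" "\<rho>\<^sup>2 = 1" using sgn by (metis power2_abs one_power2)+
    then show ?thesis using 1(11) by (simp add: power_mult_distrib)
  qed
  ultimately show ?thesis
    unfolding joined_by_length_def using 1(9,10)
    by (intro exI[of _ \<tau>] exI[of _ "\<lambda>t. R (\<eta> t)"] exI[of _ "\<lambda>t. \<sigma> * u t"]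
        exI[of _ "\<lambda>t. \<rho> * v t"] conjI) auto
qed

text \<open>Traversing an arc at a constant multiple of its speed does not change its length, so any duration
can be prescribed.\<close>

lemma joined_by_length_obtain_horizontal:
  assumes "joined_by_length X1 (X2 a b) p p' l" and "0 < \<epsilon>"
  obtains \<eta> where "horizontal X1 (X2 a b) \<epsilon> \<eta>" "\<eta> 0 = p" "\<eta> \<epsilon> = p'"
    "sR_length X1 (X2 a b) \<epsilon> \<eta> = l"
proof -
  from assms(1) obtain \<tau> \<eta> u v L S where
    1: "0 < \<tau>" "u \<in> borel_measurable borel" "v \<in> borel_measurable borel"
      "L-lipschitz_on {0..\<tau>} \<eta>" "\<And>t. \<bar>u t\<bar> \<le> L" "\<And>t. \<bar>v t\<bar> \<le> L" "finite S"
      "\<And>t. t \<in> {0<..<\<tau>} - S \<Longrightarrow>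
        (\<eta> has_vector_derivative (u t *\<^sub>R X1 (\<eta> t) + v t *\<^sub>R X2 a b (\<eta> t))) (at t)"
      "\<eta> 0 = p" "\<eta> \<tau> = p'" "((\<lambda>t. sqrt ((u t)\<^sup>2 + (v t)\<^sup>2)) has_integral l) {0..\<tau>}"
    unfolding joined_by_length_def lipschitz_horizontal_def by blast
  note [measurable] = 1(2,3)
  define k where "k = \<tau> / \<epsilon>"
  have k: "k > 0" using assms(2) 1(1) by (simp add: k_def)
  have k\<epsilon>: "k * \<epsilon> = \<tau>" "\<tau> / k = \<epsilon>" using assms(2) 1(1) by (simp_all add: k_def)
  let ?S = "(\<lambda>t. t / k) ` S"
  let ?\<eta> = "\<lambda>t. \<eta> (k * t)" and ?u = "\<lambda>t. k * u (k * t)" and ?v = "\<lambda>t. k * v (k * t)"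
  have L0: "L \<ge> 0" using 1(5)[of 0] by linarith
  have lip: "((1 + k) * L)-lipschitz_on {0..\<epsilon>} ?\<eta>"
  proof (rule lipschitz_onI)
    fix x y assume "x \<in> {0..\<epsilon>}" "y \<in> {0..\<epsilon>}"
    then have "k * x \<in> {0..\<tau>}" "k * y \<in> {0..\<tau>}"
      using k k\<epsilon> by (auto simp flip: k\<epsilon>(1))
    from lipschitz_onD[OF 1(4) this] have "dist (\<eta> (k * x)) (\<eta> (k * y)) \<le> k * L * dist x y"
      using k by (simp add: dist_real_def abs_mult mult.assoc mult.left_commute flip: right_diff_distrib)
    also have "\<dots> \<le> (1 + k) * L * dist x y"
      using k L0 by (intro mult_right_mono) auto
    finally show "dist (\<eta> (k * x)) (\<eta> (k * y)) \<le> (1 + k) * L * dist x y" .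
  qed (use k L0 in auto)
  have der: "(?\<eta> has_vector_derivative (?u t *\<^sub>R X1 (?\<eta> t) + ?v t *\<^sub>R X2 a b (?\<eta> t))) (at t)"
    if "t \<in> {0<..<\<epsilon>} - ?S" for t
  proof -
    have t: "k * t \<in> {0<..<\<tau>} - S"
      using that k k\<epsilon> by (force simp: image_iff simp flip: k\<epsilon>(1))
    have "((\<lambda>t. k * t) has_vector_derivative k) (at t)"
      by (auto intro!: derivative_eq_intros)
    from vector_diff_chain_at[OF this 1(8)[OF t]] show ?thesis
      by (simp add: o_def scaleR_add_right)
  qed
  have bd: "\<bar>k * u (k * t)\<bar> \<le> (1 + k) * L" "\<bar>k * v (k * t)\<bar> \<le> (1 + k) * L" for t
    using mult_mono[of k "1 + k" "\<bar>u (k * t)\<bar>" L] mult_mono[of k "1 + k" "\<bar>v (k * t)\<bar>" L]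
      1(5,6)[of "k * t"] k by (auto simp: abs_mult)
  have "lipschitz_horizontal X1 (X2 a b) \<epsilon> ?\<eta> ?u ?v"
    unfolding lipschitz_horizontal_def
    using 1(7) assms(2) lip der bd
    by (intro conjI exI[of _ "(1 + k) * L"] exI[of _ ?S]) auto
  then have "horizontal X1 (X2 a b) \<epsilon> ?\<eta>" by (rule lipschitz_horizontal_imp_horizontal)
  moreover have "((\<lambda>t. sqrt ((?u t)\<^sup>2 + (?v t)\<^sup>2)) has_integral l) {0..\<epsilon>}"
  proof -
    have "((\<lambda>t. sqrt ((u (k * t))\<^sup>2 + (v (k * t))\<^sup>2)) has_integral (l / k)) {0..\<epsilon>}"
      using has_integral_affinity'[OF 1(11)[unfolded box_real(2)[symmetric]] k, of 0] k\<epsilon>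
      by (simp add: divide_inverse_commute)
    from has_integral_mult_right[OF this, of k]
    have "((\<lambda>t. k * sqrt ((u (k * t))\<^sup>2 + (v (k * t))\<^sup>2)) has_integral l) {0..\<epsilon>}"
      using k by simp
    moreover have "k * sqrt ((u (k * t))\<^sup>2 + (v (k * t))\<^sup>2) = sqrt ((?u t)\<^sup>2 + (?v t)\<^sup>2)" for t
      using k by (simp add: power_mult_distrib real_sqrt_mult flip: distrib_left)
    ultimately show ?thesis by simp
  qed
  then have "sR_length X1 (X2 a b) \<epsilon> ?\<eta> = l"
    using assms(2) 1(7) der by (intro sR_length_eq_integral_speed[where S="?S"]) auto
  ultimately show ?thesis using that[of ?\<eta>] 1(9,10) k\<epsilon> by simp
qed

section \<open>Lifts of planar curves\<close>

lemma has_vector_derivative_vector_3: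
  assumes "(x has_real_derivative x') (at t)" and "(y has_real_derivative y') (at t)"
    and "(z has_real_derivative z') (at t)"
  shows "((\<lambda>t. vector [x t, y t, z t] :: real^3) has_vector_derivative vector [x', y', z']) (at t)"
proof -
  have eq: "(vector [r, s, w] :: real^3) = r *\<^sub>R axis 1 1 + s *\<^sub>R axis 2 1 + w *\<^sub>R axis 3 1"
    for r s w :: real
    by (simp add: vec_eq_iff forall_3 axis_def)
  show ?thesis
    unfolding eq using assms
    by (auto intro!: derivative_eq_intros simp: has_real_derivative_iff_has_vector_derivative)
qed

lemma frame_combination:
  "u *\<^sub>R X1 p + v *\<^sub>R X2 a b (vector [x, y, z]) = vector [u, v, (x ^ a - y ^ b)\<^sup>2 * v]"
  by (simp add: vec_eq_iff forall_3 axis_def X1_def X2_def P_def)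

text \<open>A horizontal curve is determined by its planar projection \<open>(x, y)\<close> and its initial height, since
\<open>z' = (x\<^sup>a - y\<^sup>b)\<^sup>2 y'\<close>; its length is the Euclidean length of the projection. From here on
everything is planar geometry, with the integral of \<open>(x\<^sup>a - y\<^sup>b)\<^sup>2 dy\<close> as a side condition.\<close>

lemma joined_by_C1_lift:
  assumes \<tau>: "0 < \<tau>"
    and x: "\<And>t. t \<in> {0..\<tau>} \<Longrightarrow> (x has_real_derivative u t) (at t)"
    and y: "\<And>t. t \<in> {0..\<tau>} \<Longrightarrow> (y has_real_derivative v t) (at t)"
    and z: "\<And>t. t \<in> {0..\<tau>} \<Longrightarrow> (z has_real_derivative (x t ^ a - y t ^ b)\<^sup>2 * v t) (at t)"
    and u: "continuous_on {0..\<tau>} u" and v: "continuous_on {0..\<tau>} v"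
    and len: "((\<lambda>t. sqrt ((u t)\<^sup>2 + (v t)\<^sup>2)) has_integral l) {0..\<tau>}"
  shows "joined_by_length X1 (X2 a b) (vector [x 0, y 0, z 0]) (vector [x \<tau>, y \<tau>, z \<tau>]) l"
proof -
  define \<eta> :: "real \<Rightarrow> real^3" where "\<eta> t = vector [x t, y t, z t]" for t
  define w where "w t = (x t ^ a - y t ^ b)\<^sup>2 * v t" for t
  define u' where "u' t = indicator {0..\<tau>} t *\<^sub>R u t" for t
  define v' where "v' t = indicator {0..\<tau>} t *\<^sub>R v t" for t
  have der: "(\<eta> has_vector_derivative vector [u t, v t, w t]) (at t)" if "t \<in> {0..\<tau>}" for t
    unfolding \<eta>_def w_def using that by (intro has_vector_derivative_vector_3 x y z)
  have xy: "continuous_on {0..\<tau>} x" "continuous_on {0..\<tau>} y"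
    by (rule DERIV_continuous_on[OF has_field_derivative_at_within], erule x,
        rule DERIV_continuous_on[OF has_field_derivative_at_within], erule y)
  then have w: "continuous_on {0..\<tau>} w"
    unfolding w_def by (intro continuous_intros v)
  have "\<exists>C. \<forall>t\<in>{0..\<tau>}. \<bar>g t\<bar> \<le> C" if "continuous_on {0..\<tau>} g" for g :: "real \<Rightarrow> real"
    using compact_imp_bounded[OF compact_continuous_image[OF that compact_Icc]]
    by (auto simp: bounded_iff)
  from this[OF u] this[OF v] this[OF w] obtain Cu Cv Cw where
    C: "\<And>t. t \<in> {0..\<tau>} \<Longrightarrow> \<bar>u t\<bar> \<le> Cu" "\<And>t. t \<in> {0..\<tau>} \<Longrightarrow> \<bar>v t\<bar> \<le> Cv"
      "\<And>t. t \<in> {0..\<tau>} \<Longrightarrow> \<bar>w t\<bar> \<le> Cw" by metis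
  define L where "L = Cu + Cv + Cw"
  have C0: "Cu \<ge> 0" "Cv \<ge> 0" "Cw \<ge> 0" using C[of 0] \<tau> by auto
  have "L-lipschitz_on {0..\<tau>} \<eta>"
  proof (rule bounded_derivative_imp_lipschitz)
    fix t assume t: "t \<in> {0..\<tau>}"
    show "(\<eta> has_derivative (\<lambda>h. h *\<^sub>R vector [u t, v t, w t])) (at t within {0..\<tau>})"
      using has_vector_derivative_at_within[OF der[OF t]] by (simp add: has_vector_derivative_def)
    have "norm (vector [u t, v t, w t] :: real^3) \<le> L"
      using norm_le_l1_cart[of "vector [u t, v t, w t] :: real^3"] C[OF t]
      by (simp add: sum_3 L_def)
    then show "onorm (\<lambda>h. h *\<^sub>R (vector [u t, v t, w t] :: real^3)) \<le> L"
      by (intro onorm_le) (auto intro!: mult_left_mono simp: mult.commute[of L])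
  qed (use C0 in \<open>auto simp: L_def\<close>)
  moreover have "\<bar>u' t\<bar> \<le> L" "\<bar>v' t\<bar> \<le> L" for t
    using C[of t] C0 by (auto simp: u'_def v'_def L_def indicator_def)
  moreover have "u' \<in> borel_measurable borel" "v' \<in> borel_measurable borel"
    unfolding u'_def v'_def
    by (intro borel_measurable_continuous_on_indicator u v; simp)+
  moreover have "(\<eta> has_vector_derivative (u' t *\<^sub>R X1 (\<eta> t) + v' t *\<^sub>R X2 a b (\<eta> t))) (at t)"
    if "t \<in> {0<..<\<tau>} - {}" for t
    using der[of t] that unfolding \<eta>_def frame_combination
    by (simp add: u'_def v'_def w_def)
  ultimately have "lipschitz_horizontal X1 (X2 a b) \<tau> \<eta> u' v'"
    unfolding lipschitz_horizontal_def using \<tau> by blast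
  moreover have "((\<lambda>t. sqrt ((u' t)\<^sup>2 + (v' t)\<^sup>2)) has_integral l) {0..\<tau>}"
    using len by (rule has_integral_eq[rotated]) (simp add: u'_def v'_def)
  ultimately show ?thesis
    unfolding joined_by_length_def by (intro exI[of _ \<tau>] exI[of _ \<eta>]) (auto simp: \<eta>_def)
qed

lemma joined_by_horizontal_line:
  "joined_by_length X1 (X2 a b) (vector [x, y, z]) (vector [x', y, z]) \<bar>x' - x\<bar>"
proof -
  have "joined_by_length X1 (X2 a b)
      (vector [x + (x' - x) * 0, y, z]) (vector [x + (x' - x) * 1, y, z]) \<bar>x' - x\<bar>"
    using has_integral_const_real[of "\<bar>x' - x\<bar>" 0 1]
    by (intro joined_by_C1_lift[where u = "\<lambda>_. x' - x" and v = "\<lambda>_. 0"])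
      (auto intro!: derivative_eq_intros)
  then show ?thesis by simp
qed

text \<open>The primitive of \<open>(x\<^sup>a - y\<^sup>b)\<^sup>2\<close> in the variable \<open>y\<close> that vanishes at \<open>y = 0\<close>: the height gained
along a segment parallel to the second axis is a difference of its values.\<close>

definition lift_primitive :: "nat \<Rightarrow> nat \<Rightarrow> real \<Rightarrow> real \<Rightarrow> real" where
  "lift_primitive a b x y =
     x ^ (2 * a) * y - 2 * x ^ a * (y ^ (b + 1) / (real b + 1))
       + y ^ (2 * b + 1) / (real (2 * b) + 1)"

lemma power_primitive_has_derivative:
  "((\<lambda>y. y ^ (n + 1) / (real n + 1)) has_real_derivative y ^ n) (at y)"
proof -
  have "((\<lambda>y. y ^ (n + 1)) has_real_derivative real (n + 1) * y ^ (n + 1 - Suc 0)) (at y)"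
    by (rule DERIV_pow)
  from DERIV_cdivide[OF this, of "real (n + 1)"]
  have "((\<lambda>y. y ^ (n + 1) / real (n + 1)) has_real_derivative y ^ n) (at y)"
    by (simp del: of_nat_add of_nat_Suc power_Suc)
  then show ?thesis by (simp only: of_nat_add of_nat_1)
qed

lemma lift_primitive_has_derivative:
  "(lift_primitive a b x has_real_derivative (x ^ a - y ^ b)\<^sup>2) (at y)"
proof -
  have "((\<lambda>y. x ^ (2 * a) * y - 2 * x ^ a * (y ^ (b + 1) / (real b + 1))
      + y ^ (2 * b + 1) / (real (2 * b) + 1)) has_real_derivative
      x ^ (2 * a) * 1 - 2 * x ^ a * y ^ b + y ^ (2 * b)) (at y)"
    by (intro DERIV_add DERIV_diff DERIV_cmult DERIV_ident power_primitive_has_derivative)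
  moreover have "x ^ (2 * a) * 1 - 2 * x ^ a * y ^ b + y ^ (2 * b) = (x ^ a - y ^ b)\<^sup>2"
    by (simp add: power2_diff power_mult mult.commute[of 2])
  ultimately show ?thesis unfolding lift_primitive_def by simp
qed

lemma joined_by_vertical_line:
  "joined_by_length X1 (X2 a b) (vector [x, y, z])
     (vector [x, y', z + lift_primitive a b x y' - lift_primitive a b x y]) \<bar>y' - y\<bar>"
proof -
  let ?y = "\<lambda>t. y + (y' - y) * t"
  let ?z = "\<lambda>t. z + lift_primitive a b x (?y t) - lift_primitive a b x y"
  have y: "(?y has_real_derivative (y' - y)) (at t)" for t
    by (auto intro!: derivative_eq_intros)
  have "(?z has_real_derivative (x ^ a - (?y t) ^ b)\<^sup>2 * (y' - y)) (at t)" for t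
    using DERIV_chain2[OF lift_primitive_has_derivative y, of a b x t]
    by (auto intro!: derivative_eq_intros)
  then have "joined_by_length X1 (X2 a b) (vector [x, ?y 0, ?z 0]) (vector [x, ?y 1, ?z 1]) \<bar>y' - y\<bar>"
    using has_integral_const_real[of "\<bar>y' - y\<bar>" 0 1]
    by (intro joined_by_C1_lift[where u = "\<lambda>_. 0" and v = "\<lambda>_. y' - y"])
      (auto intro!: derivative_eq_intros)
  then show ?thesis by simp
qed

section \<open>Losing height along a small square\<close>

text \<open>The height lost along the boundary of the square with sides \<open>r\<close> that starts and ends in \<open>(x, y)\<close>,
first increases \<open>x\<close> and then decreases \<open>y\<close>.\<close>

definition square_defect :: "nat \<Rightarrow> nat \<Rightarrow> real \<Rightarrow> real \<Rightarrow> real \<Rightarrow> real" where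
  "square_defect a b x y r =
     (lift_primitive a b (x + r) y - lift_primitive a b x y) -
     (lift_primitive a b (x + r) (y - r) - lift_primitive a b x (y - r))"

lemma joined_by_square:
  assumes "0 \<le> r"
  shows "joined_by_length X1 (X2 a b) (vector [x, y, z])
    (vector [x, y, z - square_defect a b x y r]) (4 * r)"
proof -
  have 1: "joined_by_length X1 (X2 a b) (vector [x, y, z]) (vector [x + r, y, z]) r" for z
    using joined_by_horizontal_line[of a b x y z "x + r"] assms by simp
  have 2: "joined_by_length X1 (X2 a b) (vector [x', y, z])
      (vector [x', y - r, z + lift_primitive a b x' (y - r) - lift_primitive a b x' y]) r" for x' z
    using joined_by_vertical_line[of a b x' y z "y - r"] assms by simp
  have 3: "joined_by_length X1 (X2 a b) (vector [x + r, y', z]) (vector [x, y', z]) r" for y' z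
    using joined_by_horizontal_line[of a b "x + r" y' z x] assms by simp
  have 4: "joined_by_length X1 (X2 a b) (vector [x, y - r, z])
      (vector [x, y, z + lift_primitive a b x y - lift_primitive a b x (y - r)]) r" for z
    using joined_by_vertical_line[of a b x "y - r" z y] assms by simp
  from joined_by_length_trans[OF joined_by_length_trans[OF joined_by_length_trans[OF 1 2] 3] 4]
  show ?thesis by (simp add: square_defect_def algebra_simps)
qed

text \<open>Let \<open>(x, y)\<close> lie on the curve \<open>x\<^sup>a = y\<^sup>b\<close>. On the left side of the square the factor
\<open>p = x\<^sup>a - s\<^sup>b\<close> is nonnegative, and on the right side it is larger than \<open>p\<close> by at least
\<open>d = r x\<^bsup>a-1\<^esup>\<close>. As \<open>(p + d)\<^sup>2 - p\<^sup>2 \<ge> d\<^sup>2\<close>, integrating over a side of length \<open>r\<close> gives a loss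
of order \<open>r\<^sup>3\<close>.\<close>

lemma square_defect_ge:
  assumes "0 < x" and "0 \<le> r" and "r \<le> y" and xy: "x ^ a = y ^ b" and "a \<ge> 1"
  shows "(x ^ (a - 1))\<^sup>2 * r ^ 3 \<le> square_defect a b x y r"
proof -
  let ?c = "(x ^ (a - 1))\<^sup>2 * r ^ 2"
  define D where "D s = lift_primitive a b (x + r) s - lift_primitive a b x s - ?c * s" for s
  \<comment> \<open>the slope of the difference of the two primitives is at least \<open>d\<^sup>2\<close>, with \<open>d = r x\<^bsup>a-1\<^esup>\<close>\<close>
  have "D (y - r) \<le> D y"
  proof (rule DERIV_nonneg_imp_nondecreasing[of "y - r" y D, rotated])
    fix s assume s: "y - r \<le> s" "s \<le> y"
    have p: "x ^ a - s ^ b \<ge> 0"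
      using s assms power_mono[of s y b] by (simp add: xy)
    have "x ^ a + r * x ^ (a - 1) = (x + r) * x ^ (a - 1)"
      using \<open>a \<ge> 1\<close> by (cases a) (auto simp: algebra_simps)
    also have "\<dots> \<le> (x + r) * (x + r) ^ (a - 1)"
      using assms by (intro mult_left_mono power_mono) auto
    also have "\<dots> = (x + r) ^ a" using \<open>a \<ge> 1\<close> by (cases a) auto
    finally have "(x ^ a - s ^ b) + r * x ^ (a - 1) \<le> (x + r) ^ a - s ^ b" by simp
    then have "((x ^ a - s ^ b) + r * x ^ (a - 1))\<^sup>2 \<le> ((x + r) ^ a - s ^ b)\<^sup>2"
      using p assms by (intro power_mono) auto
    moreover have "(x ^ a - s ^ b)\<^sup>2 + ?c \<le> ((x ^ a - s ^ b) + r * x ^ (a - 1))\<^sup>2"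
      using p assms by (simp add: power2_sum power_mult_distrib mult.commute)
    ultimately have "0 \<le> ((x + r) ^ a - s ^ b)\<^sup>2 - (x ^ a - s ^ b)\<^sup>2 - ?c" by linarith
    moreover have "(D has_real_derivative
        ((x + r) ^ a - s ^ b)\<^sup>2 - (x ^ a - s ^ b)\<^sup>2 - ?c) (at s)"
      unfolding D_def
      by (auto intro!: derivative_eq_intros lift_primitive_has_derivative)
    ultimately show "\<exists>d. (D has_real_derivative d) (at s) \<and> 0 \<le> d" by blast
  next
    show "y - r \<le> y" using assms by simp
  qed
  then show ?thesis
    by (simp add: D_def square_defect_def power3_eq_cube power2_eq_square algebra_simps)
qed

text \<open>The loss depends continuously on the side of the square, so by the intermediate value theorem every
height \<open>z\<close> up to a multiple of \<open>r\<^sup>3\<close> can be undone exactly by a loop of length at most \<open>4r\<close>.\<close>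

lemma joined_down_by_square:
  assumes "0 < x" and "0 \<le> r" and "r \<le> y" and "x ^ a = y ^ b" and "a \<ge> 1"
    and "0 \<le> z" and "z \<le> (x ^ (a - 1))\<^sup>2 * r ^ 3"
  obtains s where "0 \<le> s" "s \<le> r"
    "joined_by_length X1 (X2 a b) (vector [x, y, z]) (vector [x, y, 0]) (4 * s)"
proof -
  have "\<exists>s\<ge>0. s \<le> r \<and> square_defect a b x y s = z"
  proof (rule IVT')
    show "square_defect a b x y 0 \<le> z" using assms by (simp add: square_defect_def)
    show "z \<le> square_defect a b x y r" using square_defect_ge assms by (meson order_trans)
    show "continuous_on {0..r} (square_defect a b x y)"
      unfolding square_defect_def lift_primitive_def by (intro continuous_intros) auto
  qed fact
  then obtain s where "0 \<le> s" "s \<le> r" "square_defect a b x y s = z" by blast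
  then show ?thesis using joined_by_square[of s a b x y z] that by simp
qed

section \<open>The chord at the origin\<close>

text \<open>The primitive of \<open>(t\<^sup>a - t\<^sup>b)\<^sup>2\<close> that vanishes at \<open>t = 0\<close>: up to a constant factor, the height
gained along the chord until time \<open>t\<close>.\<close>

definition chord_defect :: "nat \<Rightarrow> nat \<Rightarrow> real \<Rightarrow> real" where
  "chord_defect a b t = t ^ (2 * a + 1) / (real (2 * a) + 1)
     - 2 * (t ^ (a + b + 1) / (real (a + b) + 1)) + t ^ (2 * b + 1) / (real (2 * b) + 1)"

lemma chord_defect_has_derivative:
  "(chord_defect a b has_real_derivative (t ^ a - t ^ b)\<^sup>2) (at t)"
proof -
  have "((\<lambda>t. t ^ (2 * a + 1) / (real (2 * a) + 1)
      - 2 * (t ^ ((a + b) + 1) / (real (a + b) + 1))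
      + t ^ (2 * b + 1) / (real (2 * b) + 1)) has_real_derivative
      t ^ (2 * a) - 2 * t ^ (a + b) + t ^ (2 * b)) (at t)"
    by (intro DERIV_add DERIV_diff DERIV_cmult power_primitive_has_derivative)
  moreover have "t ^ (2 * a) - 2 * t ^ (a + b) + t ^ (2 * b) = (t ^ a - t ^ b)\<^sup>2"
    by (simp add: power2_diff power_mult power_add mult.commute[of 2])
  ultimately show ?thesis unfolding chord_defect_def by simp
qed

lemma chord_defect_1_bounds: "0 \<le> chord_defect a b 1" "chord_defect a b 1 \<le> 2"
proof -
  have "chord_defect a b 0 \<le> chord_defect a b 1"
    by (rule DERIV_nonneg_imp_nondecreasing) (auto intro: chord_defect_has_derivative)
  then show "0 \<le> chord_defect a b 1" by (simp add: chord_defect_def)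
  have "1 / (real (2 * a) + 1) \<le> 1" "1 / (real (2 * b) + 1) \<le> 1" "1 / (real (a + b) + 1) \<ge> 0"
    by auto
  then show "chord_defect a b 1 \<le> 2" unfolding chord_defect_def power_one by linarith
qed

text \<open>On the segment from the origin to a point of the curve \<open>x\<^sup>a = y\<^sup>b\<close> the factor \<open>(x t)\<^sup>a - (y t)\<^sup>b\<close>
equals \<open>x\<^sup>a (t\<^sup>a - t\<^sup>b)\<close>, so the height gained is of order \<open>x\<^bsup>2a\<^esup> y\<close>, which is very small near the
origin.\<close>

lemma joined_by_chord:
  assumes "x ^ a = y ^ b"
  shows "joined_by_length X1 (X2 a b) (vector [0, 0, 0])
    (vector [x, y, (x ^ a)\<^sup>2 * y * chord_defect a b 1]) (sqrt (x\<^sup>2 + y\<^sup>2))"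
proof -
  let ?z = "\<lambda>t. (x ^ a)\<^sup>2 * y * chord_defect a b t"
  have "(?z has_real_derivative ((x * t) ^ a - (y * t) ^ b)\<^sup>2 * y) (at t)" for t
  proof -
    have "(x * t) ^ a - (y * t) ^ b = x ^ a * (t ^ a - t ^ b)"
      by (simp add: power_mult_distrib assms algebra_simps)
    then have eq: "((x * t) ^ a - (y * t) ^ b)\<^sup>2 = (x ^ a)\<^sup>2 * (t ^ a - t ^ b)\<^sup>2"
      by (simp add: power_mult_distrib)
    show ?thesis unfolding eq
      by (auto intro!: derivative_eq_intros chord_defect_has_derivative)
  qed
  then have "joined_by_length X1 (X2 a b) (vector [x * 0, y * 0, ?z 0]) (vector [x * 1, y * 1, ?z 1])
      (sqrt (x\<^sup>2 + y\<^sup>2))"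
    using has_integral_const_real[of "sqrt (x\<^sup>2 + y\<^sup>2)" 0 1]
    by (intro joined_by_C1_lift[where u = "\<lambda>_. x" and v = "\<lambda>_. y"])
      (auto intro!: derivative_eq_intros)
  then show ?thesis by (simp add: chord_defect_def)
qed

text \<open>The tangent line inequality for \<open>\<surd>(1 + v\<^sup>2)\<close> at \<open>m\<close> with a quadratic remainder. With
\<open>p = \<surd>(1 + v\<^sup>2) \<surd>(1 + m\<^sup>2)\<close> it follows from \<open>p\<^sup>2 - (1 + m v)\<^sup>2 = (v - m)\<^sup>2\<close>.\<close>

lemma sqrt_one_plus_square_strongly_convex:
  fixes m v K :: real
  assumes "\<bar>m\<bar> \<le> K" and "\<bar>v\<bar> \<le> K"
  shows "((1 + m * v) + (v - m)\<^sup>2 / (2 * (1 + K\<^sup>2))) / sqrt (1 + m\<^sup>2) \<le> sqrt (1 + v\<^sup>2)"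
proof -
  define p where "p = sqrt (1 + v\<^sup>2) * sqrt (1 + m\<^sup>2)"
  have K: "m\<^sup>2 \<le> K\<^sup>2" "v\<^sup>2 \<le> K\<^sup>2"
    using power_mono[OF assms(1) abs_ge_zero, of 2] power_mono[OF assms(2) abs_ge_zero, of 2]
    by simp_all
  have p2: "p\<^sup>2 = (1 + m * v)\<^sup>2 + (v - m)\<^sup>2"
    by (simp add: p_def power_mult_distrib) (simp add: power2_eq_square algebra_simps)
  have "p \<ge> 0" by (simp add: p_def)
  have ge: "1 + m * v \<le> p"
    by (rule power2_le_imp_le) (use p2 \<open>p \<ge> 0\<close> in auto)
  have "p \<le> sqrt (1 + K\<^sup>2) * sqrt (1 + K\<^sup>2)"
    unfolding p_def using K by (intro mult_mono) auto
  also have "\<dots> = 1 + K\<^sup>2" by simp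
  finally have "p \<le> 1 + K\<^sup>2" .
  from add_mono[OF this order_trans[OF ge this]]
  have "p + (1 + m * v) \<le> 2 * (1 + K\<^sup>2)" by simp
  then have "(p - (1 + m * v)) * (p + (1 + m * v)) \<le> (p - (1 + m * v)) * (2 * (1 + K\<^sup>2))"
    using ge by (intro mult_left_mono) auto
  moreover have "(p - (1 + m * v)) * (p + (1 + m * v)) = (v - m)\<^sup>2"
    using p2 by (simp add: power2_eq_square algebra_simps)
  moreover have "1 + K\<^sup>2 > 0" by (simp add: add_pos_nonneg)
  ultimately have "(1 + m * v) + (v - m)\<^sup>2 / (2 * (1 + K\<^sup>2)) \<le> p"
    by (simp add: field_simps)
  moreover have "sqrt (1 + m\<^sup>2) > 0" by (simp add: add_pos_nonneg)
  ultimately show ?thesis by (simp add: p_def pos_divide_le_eq)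
qed

lemma has_integral_powr_from_zero:
  fixes k h :: real
  assumes "0 < k" and "0 < h"
  shows "((\<lambda>t. k * t powr (k - 1)) has_integral h powr k) {0..h}"
proof -
  have "((\<lambda>t. k * t powr (k - 1)) has_integral (h powr k - 0 powr k)) {0..h}"
  proof (rule fundamental_theorem_of_calculus_interior)
    show "continuous_on {0..h} (\<lambda>t. t powr k)"
      using assms by (intro continuous_on_powr' continuous_intros) auto
    fix t assume "t \<in> {0<..<h}"
    then show "((\<lambda>t. t powr k) has_vector_derivative k * t powr (k - 1)) (at t)"
      unfolding has_real_derivative_iff_has_vector_derivative[symmetric]
      by (auto intro!: derivative_eq_intros)
  qed (use assms in auto)
  then show ?thesis using assms by simp
qed

text \<open>Strong convexity of \<open>\<surd>(1 + v\<^sup>2)\<close> at the slope \<open>m = h\<^bsup>q-1\<^esup>\<close> of the chord: the linear terms integrate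
to the length of the chord, because \<open>m\<close> is the mean of the slope \<open>v t = q t\<^bsup>q-1\<^esup>\<close>, and the quadratic
term integrates to a multiple of \<open>h\<^bsup>2q-1\<^esup>\<close>. This multiple is positive because \<open>q \<noteq> 1\<close>.\<close>

lemma chord_shorter_than_power_curve:
  fixes q h l :: real
  assumes q: "1 < q" and h: "0 < h" "h \<le> 1"
    and l: "((\<lambda>t. sqrt (1 + (q * t powr (q - 1))\<^sup>2)) has_integral l) {0..h}"
  shows "sqrt (h\<^sup>2 + (h powr q)\<^sup>2)
    + (q - 1)\<^sup>2 / (4 * (2 * q - 1) * (1 + q\<^sup>2)) * h powr (2 * q - 1) \<le> l"
proof -
  define m where "m = h powr (q - 1)"
  define w where "w = sqrt (1 + m\<^sup>2)"
  let ?v = "\<lambda>t. q * t powr (q - 1)"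
  let ?d = "h powr (2 * q - 1) * ((q - 1)\<^sup>2 / (2 * q - 1))"
  have m: "0 \<le> m" "m \<le> 1" using h q by (auto simp: m_def intro: powr_le1)
  have hq: "h powr q = h * m" "h powr (2 * q - 1) = h * m\<^sup>2"
  proof -
    have "h powr (1 + (q - 1)) = h * m" using h by (simp only: powr_add m_def) simp
    then show "h powr q = h * m" by simp
    have "h powr (1 + 2 * (q - 1)) = h * (m powr 2)"
      using h unfolding powr_add by (simp add: m_def powr_powr mult.commute)
    also have "m powr 2 = m\<^sup>2" using h by (simp add: m_def)
    also have "1 + 2 * (q - 1) = 2 * q - 1" by simp
    finally show "h powr (2 * q - 1) = h * m\<^sup>2" .
  qed
  have w: "1 \<le> w" "w \<le> 2"
  proof -
    show "1 \<le> w" by (simp add: w_def)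
    have "m\<^sup>2 \<le> 1" using m by (simp add: power_le_one)
    then have "1 + m\<^sup>2 \<le> 2\<^sup>2" by simp
    then show "w \<le> 2" unfolding w_def by (rule real_le_lsqrt[rotated]) simp
  qed
  have Iv: "(?v has_integral h powr q) {0..h}"
    using has_integral_powr_from_zero[of q h] q h by simp
  have I1: "((\<lambda>t. 1) has_integral h) {0..h}"
    using has_integral_const_real[of "1::real" 0 h] h by simp
  have "((\<lambda>t. q\<^sup>2 / (2 * q - 1) * ((2 * q - 1) * t powr (2 * q - 1 - 1)))
      has_integral q\<^sup>2 / (2 * q - 1) * h powr (2 * q - 1)) {0..h}"
    using has_integral_powr_from_zero[of "2 * q - 1" h] q h by (intro has_integral_mult_right) auto
  moreover have "q\<^sup>2 / (2 * q - 1) * ((2 * q - 1) * t powr (2 * q - 1 - 1)) = (?v t)\<^sup>2" for t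
  proof -
    have "t powr (2 * q - 1 - 1) = (t powr (q - 1))\<^sup>2"
      by (simp add: power2_eq_square flip: powr_add)
    then show ?thesis using q by (simp add: power_mult_distrib)
  qed
  ultimately have Iv2: "((\<lambda>t. (?v t)\<^sup>2) has_integral q\<^sup>2 / (2 * q - 1) * h powr (2 * q - 1)) {0..h}"
    by simp
  have Id: "((\<lambda>t. (?v t - m)\<^sup>2) has_integral ?d) {0..h}"
  proof -
    have "((\<lambda>t. (?v t)\<^sup>2 - (2 * m) * ?v t + m\<^sup>2 * 1) has_integral
        q\<^sup>2 / (2 * q - 1) * h powr (2 * q - 1) - (2 * m) * h powr q + m\<^sup>2 * h) {0..h}"
      by (intro has_integral_add has_integral_diff has_integral_mult_right Iv Iv2 I1)
    moreover have "(?v t)\<^sup>2 - (2 * m) * ?v t + m\<^sup>2 * 1 = (?v t - m)\<^sup>2" for t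
      by (simp add: power2_diff)
    moreover have "q\<^sup>2 / (2 * q - 1) * h powr (2 * q - 1) - (2 * m) * h powr q + m\<^sup>2 * h = ?d"
      unfolding hq using q by (simp add: field_simps power2_eq_square)
    ultimately show ?thesis by simp
  qed
  have "((\<lambda>t. ((1 + m * ?v t) + (1 / (2 * (1 + q\<^sup>2))) * (?v t - m)\<^sup>2) * (1 / w)) has_integral
      ((h + m * h powr q) + (1 / (2 * (1 + q\<^sup>2))) * ?d) * (1 / w)) {0..h}"
    by (intro has_integral_mult_left has_integral_add has_integral_mult_right Iv Id I1)
  then have le: "((h + m * h powr q) + (1 / (2 * (1 + q\<^sup>2))) * ?d) * (1 / w) \<le> l"
  proof (rule has_integral_le[OF _ l])
    fix t assume t: "t \<in> {0..h}"
    then have "t powr (q - 1) \<le> 1" using h q by (intro powr_le1) auto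
    then have "\<bar>?v t\<bar> \<le> q" using q by (simp add: abs_mult)
    then show "((1 + m * ?v t) + (1 / (2 * (1 + q\<^sup>2))) * (?v t - m)\<^sup>2) * (1 / w)
        \<le> sqrt (1 + (?v t)\<^sup>2)"
      using sqrt_one_plus_square_strongly_convex[of m q "?v t"] m q by (simp add: w_def)
  qed
  have chord: "sqrt (h\<^sup>2 + (h powr q)\<^sup>2) = (h + m * h powr q) * (1 / w)"
  proof -
    have "h\<^sup>2 + (h powr q)\<^sup>2 = h\<^sup>2 * (1 + m\<^sup>2)"
      by (simp add: hq power_mult_distrib algebra_simps)
    then have 1: "sqrt (h\<^sup>2 + (h powr q)\<^sup>2) = h * w"
      using h by (simp add: real_sqrt_mult w_def)
    have "h + m * h powr q = h * w\<^sup>2"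
      by (simp add: hq w_def power2_eq_square algebra_simps)
    then show ?thesis using 1 w by (simp add: power2_eq_square)
  qed
  have "(q - 1)\<^sup>2 / (4 * (2 * q - 1) * (1 + q\<^sup>2)) * h powr (2 * q - 1)
      = (1 / (2 * (1 + q\<^sup>2))) * ?d * (1 / 2)"
    using q by (simp add: field_simps)
  also have "\<dots> \<le> (1 / (2 * (1 + q\<^sup>2))) * ?d * (1 / w)"
  proof (rule mult_left_mono)
    show "1 / 2 \<le> 1 / w" using w by (simp add: field_simps)
    have "0 \<le> ?d" using q by (intro mult_nonneg_nonneg divide_nonneg_nonneg) auto
    moreover have "0 \<le> 1 / (2 * (1 + q\<^sup>2))" by simp
    ultimately show "0 \<le> (1 / (2 * (1 + q\<^sup>2))) * ?d" by (rule mult_nonneg_nonneg[rotated])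
  qed
  finally have "sqrt (h\<^sup>2 + (h powr q)\<^sup>2)
      + (q - 1)\<^sup>2 / (4 * (2 * q - 1) * (1 + q\<^sup>2)) * h powr (2 * q - 1)
      \<le> (h + m * h powr q) * (1 / w) + (1 / (2 * (1 + q\<^sup>2))) * ?d * (1 / w)"
    unfolding chord by (rule add_left_mono)
  also have "\<dots> = ((h + m * h powr q) + (1 / (2 * (1 + q\<^sup>2))) * ?d) * (1 / w)"
    by (rule distrib_right[symmetric])
  finally show ?thesis using le by (rule order_trans)
qed

section \<open>A shorter connection\<close>

lemma powr_tendsto_zero_at_right:
  fixes k :: real
  assumes "0 < k"
  shows "((\<lambda>h. h powr k) \<longlongrightarrow> 0) (at_right 0)"
proof -
  have "continuous_on {0..1} (\<lambda>h::real. h powr k)"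
    using assms by (intro continuous_on_powr' continuous_intros) auto
  then have "((\<lambda>h. h powr k) \<longlongrightarrow> 0 powr k) (at 0 within {0..1})"
    unfolding continuous_on_def by (rule bspec) simp
  then show ?thesis
    by (simp add: at_within_Icc_at_right)
qed

text \<open>\<open>P\<close> vanishes along the curve, so its lift stays at the height \<open>z\<close> at which the chord arrived.\<close>

lemma joined_along_power_curve:
  fixes \<alpha> \<beta> :: real
  assumes "\<alpha> * a = n" and "\<beta> * b = n" and h: "0 < h" "h < \<epsilon>"
    and len: "((\<lambda>t. sqrt ((\<alpha> * t powr (\<alpha> - 1))\<^sup>2 + (\<beta> * t powr (\<beta> - 1))\<^sup>2)) has_integral l) {h..\<epsilon>}"
  shows "joined_by_length X1 (X2 a b)
    (vector [h powr \<alpha>, h powr \<beta>, z]) (vector [\<epsilon> powr \<alpha>, \<epsilon> powr \<beta>, z]) l"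
proof -
  have pw: "((\<lambda>t. (h + t) powr k) has_real_derivative k * (h + t) powr (k - 1)) (at t)"
    "continuous_on {0..\<epsilon> - h} (\<lambda>t. k * (h + t) powr (k - 1))"
    if "t \<in> {0..\<epsilon> - h}" for t k
    using that h by (auto intro!: derivative_eq_intros continuous_intros)
  have P: "((h + t) powr \<alpha>) ^ a = ((h + t) powr \<beta>) ^ b" if "t \<in> {0..\<epsilon> - h}" for t
    using that h assms(1,2) by (simp add: powr_powr powr_realpow[symmetric])
  have "joined_by_length X1 (X2 a b) (vector [(h + 0) powr \<alpha>, (h + 0) powr \<beta>, z])
      (vector [(h + (\<epsilon> - h)) powr \<alpha>, (h + (\<epsilon> - h)) powr \<beta>, z]) l"
  proof (rule joined_by_C1_lift)
    show "((\<lambda>t. sqrt ((\<alpha> * (h + t) powr (\<alpha> - 1))\<^sup>2 + (\<beta> * (h + t) powr (\<beta> - 1))\<^sup>2))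
        has_integral l) {0..\<epsilon> - h}"
      using has_integral_shift_real_ivl[OF len, of h] by (simp add: add.commute)
  qed (use h P in \<open>auto intro!: pw[of 0] pw\<close>)
  then show ?thesis by simp
qed

text \<open>The competitor in the quadrant where both signs are positive. The side \<open>r\<close> allowed for the correcting
square is chosen so that its perimeter is half of the length saved by the chord; that the square can
then remove the height of the chord for small \<open>h\<close> is what the inequality \<open>6q < 2n + 4\<close> says.\<close>

lemma shorter_connection:
  fixes q \<alpha> \<beta> :: real and a b n :: nat
  assumes "a \<ge> 1" and q: "1 < q" and \<alpha>\<beta>: "(\<alpha> = 1 \<and> \<beta> = q) \<or> (\<alpha> = q \<and> \<beta> = 1)"
    and n: "\<alpha> * a = n" "\<beta> * b = n" and key: "6 * q < 2 * real n + 4" and \<epsilon>: "0 < \<epsilon>"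
    and L: "((\<lambda>t. sqrt (1 + (q * t powr (q - 1))\<^sup>2)) has_integral L) {0..\<epsilon>}"
  obtains l where "l < L" and
    "joined_by_length X1 (X2 a b) (vector [0, 0, 0]) (vector [\<epsilon> powr \<alpha>, \<epsilon> powr \<beta>, 0]) l"
proof -
  let ?f = "\<lambda>t. sqrt (1 + (q * t powr (q - 1))\<^sup>2)"
  define C where "C = (q - 1)\<^sup>2 / (4 * (2 * q - 1) * (1 + q\<^sup>2))"
  define x where "x = \<epsilon> powr \<alpha>"
  define y where "y = \<epsilon> powr \<beta>"
  define c where "c = (x ^ (a - 1))\<^sup>2"
  have pos: "C > 0" "x > 0" "y > 0" "c > 0"
    using q \<epsilon> by (auto simp: C_def x_def y_def c_def intro!: divide_pos_pos mult_pos_pos add_pos_nonneg)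
  \<comment> \<open>the square must fit below \<open>y\<close>\<close>
  have "\<forall>\<^sub>F h in at_right 0. h powr (2 * q - 1) < 8 * y / C"
    using q pos by (intro order_tendstoD(2)[OF powr_tendsto_zero_at_right]) auto
  \<comment> \<open>the height of the chord, at most \<open>2 h\<^bsup>2n+1\<^esup>\<close>, must stay below \<open>c r\<^sup>3\<close>, a multiple of \<open>h\<^bsup>6q-3\<^esup>\<close>\<close>
  moreover have "\<forall>\<^sub>F h in at_right 0. h powr (2 * real n + 4 - 6 * q) < c * (C / 8) ^ 3 / 2"
    using key pos by (intro order_tendstoD(2)[OF powr_tendsto_zero_at_right]) auto
  moreover have "\<forall>\<^sub>F h in at_right 0. h \<in> {0<..<min 1 \<epsilon>}"
    using \<epsilon> by (intro eventually_at_right_real) auto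
  ultimately have "\<forall>\<^sub>F h in at_right 0. h powr (2 * q - 1) < 8 * y / C \<and>
      h powr (2 * real n + 4 - 6 * q) < c * (C / 8) ^ 3 / 2 \<and> h \<in> {0<..<min 1 \<epsilon>}"
    by eventually_elim blast
  from eventually_happens[OF this] obtain h where
    h1: "h powr (2 * q - 1) < 8 * y / C" and
    h2: "h powr (2 * real n + 4 - 6 * q) < c * (C / 8) ^ 3 / 2" and
    h: "0 < h" "h < 1" "h < \<epsilon>" by (auto simp: trivial_limit_at_right_real)
  define r where "r = C / 8 * h powr (2 * q - 1)"
  have r: "0 < r" "r \<le> y" using pos h h1 by (auto simp: r_def field_simps)
  define z where "z = (h ^ n)\<^sup>2 * h powr \<beta> * chord_defect a b 1"
  have hn: "(t powr \<alpha>) ^ a = t ^ n" "(t powr \<beta>) ^ b = t ^ n" if "0 < t" for t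
    using that n by (simp_all add: powr_powr powr_realpow[symmetric])
  have z: "0 \<le> z" "z \<le> c * r ^ 3"
  proof -
    show "0 \<le> z" using chord_defect_1_bounds h by (simp add: z_def)
    have cube: "h powr (3 * (2 * q - 1)) = (h powr (2 * q - 1)) ^ 3"
      by (simp add: power3_eq_cube flip: powr_add)
    have "h powr \<beta> \<le> h powr 1"
      using \<alpha>\<beta> q h by (intro powr_mono') auto
    then have "z \<le> (h ^ n)\<^sup>2 * h * 2"
      unfolding z_def using chord_defect_1_bounds h by (intro mult_mono) auto
    also have "(h ^ n)\<^sup>2 * h = h powr ((2 * real n + 4 - 6 * q) + 3 * (2 * q - 1))"
    proof -
      have "(h ^ n)\<^sup>2 * h = h powr (real (2 * n + 1))"
        using h by (subst powr_realpow) (auto simp: power_mult mult.commute[of 2])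
      moreover have "real (2 * n + 1) = (2 * real n + 4 - 6 * q) + 3 * (2 * q - 1)" by simp
      ultimately show ?thesis by (simp only:)
    qed
    also have "\<dots> = h powr (2 * real n + 4 - 6 * q) * (h powr (2 * q - 1)) ^ 3"
      unfolding powr_add cube ..
    also have "\<dots> * 2 \<le> (c * (C / 8) ^ 3 / 2) * (h powr (2 * q - 1)) ^ 3 * 2"
      using h2 h by (intro mult_right_mono) auto
    also have "\<dots> = c * r ^ 3" by (simp add: r_def flip: power_mult_distrib)
    finally show "z \<le> c * r ^ 3" .
  qed
  have int: "?f integrable_on {0..h}" "?f integrable_on {h..\<epsilon>}"
    using integrable_subinterval_real[OF has_integral_integrable[OF L]] h by auto
  define l1 where "l1 = integral {0..h} ?f"
  define l2 where "l2 = integral {h..\<epsilon>} ?f"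
  have l1: "(?f has_integral l1) {0..h}" and l2: "(?f has_integral l2) {h..\<epsilon>}"
    using int by (auto simp: l1_def l2_def)
  have "L = l1 + l2"
    using has_integral_unique[OF L has_integral_combine[OF _ _ l1 l2]] h by simp
  \<comment> \<open>the two choices of exponents differ by the order of the summands only\<close>
  have "sqrt (h\<^sup>2 + (h powr q)\<^sup>2) = sqrt ((h powr \<alpha>)\<^sup>2 + (h powr \<beta>)\<^sup>2)"
    using \<alpha>\<beta> h by (auto simp: add.commute)
  then have gain: "sqrt ((h powr \<alpha>)\<^sup>2 + (h powr \<beta>)\<^sup>2) + C * h powr (2 * q - 1) \<le> l1"
    using chord_shorter_than_power_curve[OF q _ _ l1] h by (simp add: C_def)
  have chord: "joined_by_length X1 (X2 a b) (vector [0, 0, 0]) (vector [h powr \<alpha>, h powr \<beta>, z])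
      (sqrt ((h powr \<alpha>)\<^sup>2 + (h powr \<beta>)\<^sup>2))"
    using joined_by_chord[of "h powr \<alpha>" a "h powr \<beta>" b] h by (simp add: hn z_def)
  have "((\<lambda>t. sqrt ((\<alpha> * t powr (\<alpha> - 1))\<^sup>2 + (\<beta> * t powr (\<beta> - 1))\<^sup>2)) has_integral l2) {h..\<epsilon>}"
    using l2 by (rule has_integral_eq[rotated]) (use \<alpha>\<beta> h in \<open>auto simp: add.commute\<close>)
  then have along: "joined_by_length X1 (X2 a b)
      (vector [h powr \<alpha>, h powr \<beta>, z]) (vector [x, y, z]) l2"
    unfolding x_def y_def using n h by (intro joined_along_power_curve) auto
  have "x ^ a = y ^ b" using hn[OF \<epsilon>] by (simp add: x_def y_def)
  then obtain s where s: "0 \<le> s" "s \<le> r"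
    "joined_by_length X1 (X2 a b) (vector [x, y, z]) (vector [x, y, 0]) (4 * s)"
    using joined_down_by_square[of x r y a b z] pos r z \<open>a \<ge> 1\<close> unfolding c_def by auto
  have "4 * s < C * h powr (2 * q - 1)" using s r by (simp add: r_def)
  then have "sqrt ((h powr \<alpha>)\<^sup>2 + (h powr \<beta>)\<^sup>2) + l2 + 4 * s < L"
    using gain \<open>L = l1 + l2\<close> by linarith
  then show ?thesis
    using that joined_by_length_trans[OF joined_by_length_trans[OF chord along] s(3)]
    unfolding x_def y_def by blast
qed

text \<open>The reflection that carries \<open>(x, y)\<close> to \<open>(\<sigma>1 x, \<sigma>2 y)\<close> multiplies \<open>P\<close> by the common sign of \<open>\<sigma>1\<^sup>a\<close> and
\<open>\<sigma>2\<^sup>b\<close>, so it lifts to a symmetry of the structure that multiplies the height by \<open>\<sigma>2\<close>.\<close>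

lemma joined_by_length_reflection:
  assumes \<sigma>: "\<bar>\<sigma>1\<bar> = 1" "\<bar>\<sigma>2\<bar> = 1" "\<sigma>1 ^ a = \<sigma>2 ^ b"
    and "joined_by_length X1 (X2 a b) (vector [0, 0, 0]) (vector [x, y, 0]) l"
  shows "joined_by_length X1 (X2 a b) (vector [0, 0, 0]) (vector [\<sigma>1 * x, \<sigma>2 * y, 0]) l"
proof -
  define R :: "real^3 \<Rightarrow> real^3" where
    "R p = vector [\<sigma>1 * p $ 1, \<sigma>2 * p $ 2, \<sigma>2 * p $ 3]" for p
  have "linear R"
    by (rule linearI) (auto simp: R_def vec_eq_iff forall_3 algebra_simps)
  then have "bounded_linear R" by (simp add: linear_conv_bounded_linear)
  moreover have "R (X1 p) = \<sigma>1 *\<^sub>R X1 (R p)" for p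
    by (simp add: R_def X1_def vec_eq_iff forall_3 axis_def)
  moreover have "R (X2 a b p) = \<sigma>2 *\<^sub>R X2 a b (R p)" for p
  proof -
    have "P a b (R p) = \<sigma>2 ^ b * P a b p"
      by (simp add: P_def R_def power_mult_distrib \<sigma>(3) algebra_simps)
    moreover have "(\<sigma>2 ^ b)\<^sup>2 = 1"
      using \<sigma>(2) by (metis power2_abs power_abs power_one)
    ultimately have "(P a b (R p))\<^sup>2 = (P a b p)\<^sup>2" by (simp add: power_mult_distrib)
    then show ?thesis by (simp add: R_def X2_def vec_eq_iff forall_3 axis_def)
  qed
  ultimately have "joined_by_length X1 (X2 a b) (R (vector [0, 0, 0])) (R (vector [x, y, 0])) l"
    by (rule joined_by_length_linear_image[OF assms(4)]) fact+
  then show ?thesis by (simp add: R_def)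
qed

section \<open>The curves\<close>

text \<open>One description of the curves for \<open>a < b\<close> and \<open>a > b\<close>, which lets both cases share all estimates.\<close>

lemma \<gamma>_eq_signed_powers:
  assumes "a \<noteq> b" "a \<ge> 1" "b \<ge> 1"
  obtains \<alpha> \<beta> where "(\<alpha> = 1 \<and> \<beta> = q a b) \<or> (\<alpha> = q a b \<and> \<beta> = 1)"
    "\<alpha> * real a = real (max a b)" "\<beta> * real b = real (max a b)"
    "\<And>\<sigma>1 \<sigma>2 t. 0 \<le> t \<Longrightarrow> \<gamma> a b \<sigma>1 \<sigma>2 t = vector [\<sigma>1 * t powr \<alpha>, \<sigma>2 * t powr \<beta>, 0]"
proof (cases "a < b")
  case True
  then show ?thesis using assms by (intro that[of "q a b" 1]) (auto simp: \<gamma>_def q_def)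
next
  case False
  then show ?thesis using assms by (intro that[of 1 "q a b"]) (auto simp: \<gamma>_def q_def)
qed

lemma signed_power_curve_has_vector_derivative:
  assumes "0 < t" and \<eta>: "\<And>t. 0 \<le> t \<Longrightarrow> \<eta> t = vector [\<sigma>1 * t powr \<alpha>, \<sigma>2 * t powr \<beta>, 0]"
  shows "(\<eta> has_vector_derivative
    (vector [\<sigma>1 * (\<alpha> * t powr (\<alpha> - 1)), \<sigma>2 * (\<beta> * t powr (\<beta> - 1)), 0] :: real^3)) (at t)"
proof (rule has_vector_derivative_transform_within_open[of _ _ _ "{0<..}"])
  show "((\<lambda>t. vector [\<sigma>1 * t powr \<alpha>, \<sigma>2 * t powr \<beta>, 0] :: real^3) has_vector_derivative
    vector [\<sigma>1 * (\<alpha> * t powr (\<alpha> - 1)), \<sigma>2 * (\<beta> * t powr (\<beta> - 1)), 0]) (at t)"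
    using assms(1) by (intro has_vector_derivative_vector_3) (auto intro!: derivative_eq_intros)
qed (use assms in auto)

text \<open>If the signs do not match, then \<open>P\<close> does not vanish along the curve. A horizontal curve of constant
height would need a zero second control there, but the second coordinate moves.\<close>

lemma power_curve_not_horizontal:
  assumes \<eta>: "\<And>t. 0 \<le> t \<Longrightarrow> \<eta> t = vector [\<sigma>1 * t powr \<alpha>, \<sigma>2 * t powr \<beta>, 0]"
    and n: "\<alpha> * real a = real n" "\<beta> * real b = real n" and "\<beta> \<noteq> 0" "\<sigma>2 \<noteq> 0" "0 < \<epsilon>"
    and "\<sigma>1 ^ a \<noteq> \<sigma>2 ^ b"
  shows "\<not> horizontal X1 (X2 a b) \<epsilon> \<eta>"
proof
  assume "horizontal X1 (X2 a b) \<epsilon> \<eta>"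
  then obtain u v where "AE t in lebesgue_on {0..\<epsilon>}.
      (\<eta> has_vector_derivative (u t *\<^sub>R X1 (\<eta> t) + v t *\<^sub>R X2 a b (\<eta> t))) (at t within {0..\<epsilon>})"
    unfolding horizontal_def by blast
  then have ae: "AE t in lebesgue. t \<in> {0..\<epsilon>} \<longrightarrow>
      (\<eta> has_vector_derivative (u t *\<^sub>R X1 (\<eta> t) + v t *\<^sub>R X2 a b (\<eta> t))) (at t within {0..\<epsilon>})"
    by (simp add: AE_restrict_space_iff)
  have "\<not> (\<eta> has_vector_derivative (u t *\<^sub>R X1 (\<eta> t) + v t *\<^sub>R X2 a b (\<eta> t))) (at t within {0..\<epsilon>})"
    if t: "t \<in> {0<..<\<epsilon>}" for t
  proof
    assume der: "(\<eta> has_vector_derivative (u t *\<^sub>R X1 (\<eta> t) + v t *\<^sub>R X2 a b (\<eta> t)))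
      (at t within {0..\<epsilon>})"
    have der': "(\<eta> has_vector_derivative
        (vector [\<sigma>1 * (\<alpha> * t powr (\<alpha> - 1)), \<sigma>2 * (\<beta> * t powr (\<beta> - 1)), 0] :: real^3))
        (at t within {0..\<epsilon>})"
      by (rule has_vector_derivative_at_within, rule signed_power_curve_has_vector_derivative[OF _ \<eta>])
        (use t in auto)
    have "at t within {0..\<epsilon>} \<noteq> bot"
      using t by (simp add: trivial_limit_within islimpt_Icc)
    from vector_derivative_unique_within[OF this der der']
    have "u t *\<^sub>R X1 (\<eta> t) + v t *\<^sub>R X2 a b (\<eta> t)
        = vector [\<sigma>1 * (\<alpha> * t powr (\<alpha> - 1)), \<sigma>2 * (\<beta> * t powr (\<beta> - 1)), 0]" .
    moreover have "\<eta> t = vector [\<sigma>1 * t powr \<alpha>, \<sigma>2 * t powr \<beta>, 0]"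
      using t by (intro \<eta>) auto
    ultimately have vec: "(vector [u t, v t,
          ((\<sigma>1 * t powr \<alpha>) ^ a - (\<sigma>2 * t powr \<beta>) ^ b)\<^sup>2 * v t] :: real^3)
        = vector [\<sigma>1 * (\<alpha> * t powr (\<alpha> - 1)), \<sigma>2 * (\<beta> * t powr (\<beta> - 1)), 0]"
      by (simp only: frame_combination)
    have eq: "v t = \<sigma>2 * (\<beta> * t powr (\<beta> - 1))"
      "((\<sigma>1 * t powr \<alpha>) ^ a - (\<sigma>2 * t powr \<beta>) ^ b)\<^sup>2 * v t = 0"
      using arg_cong[OF vec, of "\<lambda>p. p $ 2"] arg_cong[OF vec, of "\<lambda>p. p $ 3"]
      by (simp_all only: vector_3)
    have "(\<sigma>1 * t powr \<alpha>) ^ a - (\<sigma>2 * t powr \<beta>) ^ b = (\<sigma>1 ^ a - \<sigma>2 ^ b) * t ^ n"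
      using t n by (simp add: power_mult_distrib powr_powr powr_realpow[symmetric] algebra_simps)
    then show False using eq t assms(4,5,7) by auto
  qed
  then have "AE t in lebesgue. t \<notin> {0<..<\<epsilon>}"
    using ae by (auto elim!: eventually_mono)
  then have "{0<..<\<epsilon>} \<in> null_sets lebesgue"
    by (subst (asm) AE_iff_null_sets[symmetric]) auto
  then have "emeasure lebesgue {0<..<\<epsilon>} = 0" by blast
  then show False using \<open>0 < \<epsilon>\<close> by simp
qed

theorem theorem1p2:
  fixes a b :: nat
  assumes "a \<ge> 1" and "b \<ge> 1"
    and "(b > a \<and> a \<ge> 3) \<or> (a = 2 \<and> b = 3) \<or> (a > b \<and> b \<ge> 3) \<or> (b = 2 \<and> a = 3)"
  shows "\<forall>\<epsilon>>0. \<forall>\<sigma>1\<in>{-1, 1}. \<forall>\<sigma>2\<in>{-1, 1}.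
           \<not> length_minimizing X1 (X2 a b) \<epsilon> (\<gamma> a b \<sigma>1 \<sigma>2)"
proof (intro allI impI ballI notI)
  fix \<epsilon> \<sigma>1 \<sigma>2 :: real
  assume \<epsilon>: "0 < \<epsilon>" and "\<sigma>1 \<in> {-1, 1}" "\<sigma>2 \<in> {-1, 1}"
    and min: "length_minimizing X1 (X2 a b) \<epsilon> (\<gamma> a b \<sigma>1 \<sigma>2)"
  then have \<sigma>: "\<bar>\<sigma>1\<bar> = 1" "\<bar>\<sigma>2\<bar> = 1" by auto
  define n where "n = max a b"
  have "a \<noteq> b" using assms by auto
  then obtain \<alpha> \<beta> where \<alpha>\<beta>: "(\<alpha> = 1 \<and> \<beta> = q a b) \<or> (\<alpha> = q a b \<and> \<beta> = 1)"
    and n: "\<alpha> * real a = real n" "\<beta> * real b = real n"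
    and \<gamma>: "\<And>\<sigma>1 \<sigma>2 t. 0 \<le> t \<Longrightarrow> \<gamma> a b \<sigma>1 \<sigma>2 t = vector [\<sigma>1 * t powr \<alpha>, \<sigma>2 * t powr \<beta>, 0]"
    using \<gamma>_eq_signed_powers[of a b] assms unfolding n_def by metis
  \<comment> \<open>this is where the hypotheses on \<open>a\<close> and \<open>b\<close> enter\<close>
  have q: "1 < q a b" "6 * q a b < 2 * real n + 4"
  proof -
    show "1 < q a b" using assms by (auto simp: q_def)
    \<comment> \<open>with \<open>q = n / k\<close> the claim holds for \<open>k \<ge> 3\<close>; for \<open>k = 2\<close>, \<open>n = 3\<close> it reads \<open>9 < 10\<close>\<close>
    have "6 * real n < (2 * real n + 4) * real k" if "3 \<le> k" for k
    proof -
      have "(2 * real n + 4) * 3 \<le> (2 * real n + 4) * real k"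
        using that by (intro mult_left_mono) auto
      then show ?thesis by simp
    qed
    then show "6 * q a b < 2 * real n + 4"
      using assms by (auto simp: q_def n_def pos_divide_less_eq)
  qed
  have \<sigma>ab: "\<sigma>1 ^ a = \<sigma>2 ^ b"
  proof (rule ccontr)
    assume "\<sigma>1 ^ a \<noteq> \<sigma>2 ^ b"
    then have "\<not> horizontal X1 (X2 a b) \<epsilon> (\<gamma> a b \<sigma>1 \<sigma>2)"
      using \<gamma> n \<alpha>\<beta> q \<sigma> \<epsilon> by (intro power_curve_not_horizontal[of _ \<sigma>1 \<alpha> \<sigma>2 \<beta> a n]) auto
    then show False using min by (simp add: length_minimizing_def)
  qed
  let ?f = "\<lambda>t. sqrt (1 + (q a b * t powr (q a b - 1))\<^sup>2)"
  have "continuous_on {0..\<epsilon>} ?f"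
    using q by (intro continuous_intros continuous_on_powr') auto
  then obtain L where L: "(?f has_integral L) {0..\<epsilon>}"
    using integrable_continuous_real by blast
  have len: "sR_length X1 (X2 a b) \<epsilon> (\<gamma> a b \<sigma>1 \<sigma>2) = L"
  proof (rule sR_length_eq_integral_speed)
    let ?u = "\<lambda>t. \<sigma>1 * (\<alpha> * t powr (\<alpha> - 1))" and ?v = "\<lambda>t. \<sigma>2 * (\<beta> * t powr (\<beta> - 1))"
    fix t assume t: "t \<in> {0<..<\<epsilon>} - {}"
    have "(\<sigma>1 * t powr \<alpha>) ^ a = (\<sigma>2 * t powr \<beta>) ^ b"
      using t n by (simp add: power_mult_distrib \<sigma>ab powr_powr powr_realpow[symmetric])
    then have "?u t *\<^sub>R X1 (\<gamma> a b \<sigma>1 \<sigma>2 t) + ?v t *\<^sub>R X2 a b (\<gamma> a b \<sigma>1 \<sigma>2 t)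
        = vector [?u t, ?v t, 0]"
      using t by (simp add: \<gamma> frame_combination)
    then show "(\<gamma> a b \<sigma>1 \<sigma>2 has_vector_derivative
        (?u t *\<^sub>R X1 (\<gamma> a b \<sigma>1 \<sigma>2 t) + ?v t *\<^sub>R X2 a b (\<gamma> a b \<sigma>1 \<sigma>2 t))) (at t)"
      using signed_power_curve_has_vector_derivative[OF _ \<gamma>, of t \<sigma>1 \<sigma>2] t by simp
  next
    have "\<sigma>1\<^sup>2 = 1" "\<sigma>2\<^sup>2 = 1" using \<sigma> by (metis power2_abs one_power2)+
    then show "((\<lambda>t. sqrt ((\<sigma>1 * (\<alpha> * t powr (\<alpha> - 1)))\<^sup>2 + (\<sigma>2 * (\<beta> * t powr (\<beta> - 1)))\<^sup>2))
        has_integral L) {0..\<epsilon>}"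
      by (intro has_integral_spike[OF _ _ L, of "{0}"])
        (use \<alpha>\<beta> in \<open>auto simp: power_mult_distrib add.commute\<close>)
  qed (use \<epsilon> in auto)
  obtain l where l: "l < L"
    "joined_by_length X1 (X2 a b) (vector [0, 0, 0]) (vector [\<epsilon> powr \<alpha>, \<epsilon> powr \<beta>, 0]) l"
    using shorter_connection[OF \<open>a \<ge> 1\<close> q(1) \<alpha>\<beta> n q(2) \<epsilon> L] .
  have "joined_by_length X1 (X2 a b) (\<gamma> a b \<sigma>1 \<sigma>2 0) (\<gamma> a b \<sigma>1 \<sigma>2 \<epsilon>) l"
    using joined_by_length_reflection[OF \<sigma> \<sigma>ab l(2)] \<gamma> \<epsilon> by simp
  from joined_by_length_obtain_horizontal[OF this \<epsilon>] obtain \<theta> where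
    "horizontal X1 (X2 a b) \<epsilon> \<theta>" "\<theta> 0 = \<gamma> a b \<sigma>1 \<sigma>2 0" "\<theta> \<epsilon> = \<gamma> a b \<sigma>1 \<sigma>2 \<epsilon>"
    "sR_length X1 (X2 a b) \<epsilon> \<theta> = l" .
  then show False using min len l(1) by (force simp: length_minimizing_def)
qed

end
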